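(* Let $G$ be a connected graph. Then every independent set of $G$ is a mutual-visibility set if and only if $G$ contains no independent strong critical set.
   Context: All graphs are finite and simple. For $X\subseteq V(G)$, two vertices $u,v$ are $X$-visible if there is a shortest $u,v$-path $P$ with $V(P)\cap X\subseteq\{u,v\}$; $X$ is a mutual-visibility set if any two vertices of $X$ are $X$-visible. For vertices $u,v$, a set $S\subset V(G)$ is $\{u,v\}$-critical if $u,v\notin S$ and $d_{G-S}(u,v)>d_G(u,v)$ (distance $\infty$ if no path exists); it is strong $\{u,v\}$-critical if moreover no vertex of $S$ is adjacent to $u$ or to $v$. A (strong) critical set is a set that is (strong) $\{u,v\}$-critical for some vertices $u,v$. *)

theory Defs
  imports "Graph_Theory.Graph_Theory"
begin

text \<open>
  A finite simple graph is a \<^locale>\<open>graph\<close> of the AFP digraph library: a finite symmetric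
  digraph without loops and parallel arcs, each undirected edge being represented by its two
  orientations.
\<close>

text \<open>
  The weighted distance of the library for unit weights; it is \<open>\<infinity>\<close> if there is no walk
  from \<open>u\<close> to \<open>v\<close>. (\<open>wf_digraph.\<mu>\<close> is meaningful for well-formed \<open>G\<close>
  only, which covers a \<^locale>\<open>graph\<close> and its induced subgraphs.)
\<close>
definition graph_dist :: "('a,'b) pre_digraph \<Rightarrow> 'a \<Rightarrow> 'a \<Rightarrow> ereal" where
  "graph_dist G u v = wf_digraph.\<mu> G (\<lambda>_. 1) u v"

text \<open>Paths are lists of arcs, so the length of the list is the length of the path.\<close>
definition shortest_path :: "('a,'b) pre_digraph \<Rightarrow> 'a \<Rightarrow> 'b awalk \<Rightarrow> 'a \<Rightarrow> bool" where
  "shortest_path G u p v \<longleftrightarrow>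
    pre_digraph.apath G u p v \<and> ereal (real (length p)) = graph_dist G u v"

definition visible :: "('a,'b) pre_digraph \<Rightarrow> 'a set \<Rightarrow> 'a \<Rightarrow> 'a \<Rightarrow> bool" where
  "visible G X u v \<longleftrightarrow>
    (\<exists>p. shortest_path G u p v \<and> set (pre_digraph.awalk_verts G u p) \<inter> X \<subseteq> {u, v})"

definition mutual_visibility_set :: "('a,'b) pre_digraph \<Rightarrow> 'a set \<Rightarrow> bool" where
  "mutual_visibility_set G X \<longleftrightarrow>
    X \<subseteq> verts G \<and> (\<forall>u\<in>X. \<forall>v\<in>X. u \<noteq> v \<longrightarrow> visible G X u v)"

definition independent_set :: "('a,'b) pre_digraph \<Rightarrow> 'a set \<Rightarrow> bool" where
  "independent_set G X \<longleftrightarrow> X \<subseteq> verts G \<and> (\<forall>u\<in>X. \<forall>v\<in>X. \<not> u \<rightarrow>\<^bsub>G\<^esub> v)"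

definition delete_verts :: "('a,'b) pre_digraph \<Rightarrow> 'a set \<Rightarrow> ('a,'b) pre_digraph" where
  "delete_verts G S = G \<restriction> (verts G - S)"

definition critical :: "('a,'b) pre_digraph \<Rightarrow> 'a \<Rightarrow> 'a \<Rightarrow> 'a set \<Rightarrow> bool" where
  "critical G u v S \<longleftrightarrow>
    S \<subseteq> verts G \<and> u \<notin> S \<and> v \<notin> S \<and> graph_dist (delete_verts G S) u v > graph_dist G u v"

definition strong_critical :: "('a,'b) pre_digraph \<Rightarrow> 'a \<Rightarrow> 'a \<Rightarrow> 'a set \<Rightarrow> bool" where
  "strong_critical G u v S \<longleftrightarrow>
    critical G u v S \<and> (\<forall>s\<in>S. \<not> u \<rightarrow>\<^bsub>G\<^esub> s \<and> \<not> v \<rightarrow>\<^bsub>G\<^esub> s)"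

definition strong_critical_set :: "('a,'b) pre_digraph \<Rightarrow> 'a set \<Rightarrow> bool" where
  "strong_critical_set G S \<longleftrightarrow> (\<exists>u\<in>verts G. \<exists>v\<in>verts G. strong_critical G u v S)"

end

theory Submission
  imports Defs
begin

text \<open>
  The proof rests on one equivalence: in a connected graph, two vertices \<open>u, v\<close> are \<open>X\<close>-visible
  iff \<open>X - {u, v}\<close> is not \<open>{u, v}\<close>-critical, because a shortest path of \<open>G\<close> that avoids \<open>S\<close> is the
  same thing as a path of \<open>G - S\<close> of length \<open>d(u, v)\<close>. If \<open>X\<close> is independent and contains \<open>u\<close> and
  \<open>v\<close>, then \<open>X - {u, v}\<close> has no neighbour of \<open>u\<close> or \<open>v\<close>. Conversely, a strong \<open>{u, v}\<close>-critical
  independent set \<open>S\<close> extends to the independent set \<open>S \<union> {u, v}\<close>: vertices that are equal or adjacent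
  see each other through any set, so \<open>u\<close> and \<open>v\<close> are distinct and not adjacent.
\<close>

lemma (in wf_digraph) graph_dist_le_length:
  assumes "awalk u p v"
  shows "graph_dist G u v \<le> ereal (real (length p))"
  using min_cost_le_walk_cost[OF assms, of "\<lambda>_. 1"]
  by (simp add: graph_dist_def awalk_cost_def sum_list_triv)

lemma (in fin_digraph) ex_shortest_path:
  assumes "u \<rightarrow>\<^sup>* v"
  shows "\<exists>p. shortest_path G u p v"
  using min_cost_awalk[OF assms, of "\<lambda>_. 1"]
  by (auto simp: shortest_path_def graph_dist_def awalk_cost_def sum_list_triv)

lemma (in sym_digraph) reachable_if_connected:
  assumes "connected G" "u \<in> verts G" "v \<in> verts G"
  shows "u \<rightarrow>\<^sup>* v"
  using symmetric_connected_imp_strongly_connected[OF sym_arcs assms(1)] assms(2,3)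
  by auto

lemma (in digraph) digraph_delete_verts: "digraph (delete_verts G S)"
  unfolding delete_verts_def
  by (rule digraphI_induced) (rule induced_induce, auto)

text \<open>Deletion keeps the tail and head maps, so a list of arcs visits the same vertices in
  both graphs and only their membership in \<open>S\<close> matters.\<close>

lemma (in wf_digraph) awalk_delete_verts_iff:
  assumes "u \<in> verts G"
  shows "pre_digraph.awalk (delete_verts G S) u p v \<longleftrightarrow> awalk u p v \<and> set (awalk_verts u p) \<inter> S = {}"
proof -
  interpret D: wf_digraph "delete_verts G S"
    unfolding delete_verts_def by auto
  have verts_eq: "D.awalk_verts = awalk_verts"
    unfolding delete_verts_def by (rule awalk_verts_induce)
  have sub: "subgraph (delete_verts G S) G"
    unfolding delete_verts_def by (rule subgraph_induce_subgraphI) auto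
  show ?thesis
  proof
    assume walk: "D.awalk u p v"
    then have "set (awalk_verts u p) \<subseteq> verts G - S"
      unfolding D.awalk_conv verts_eq by (simp add: delete_verts_def)
    then show "awalk u p v \<and> set (awalk_verts u p) \<inter> S = {}"
      using subgraph_awalk_imp_awalk[OF walk sub] by auto
  next
    assume "awalk u p v \<and> set (awalk_verts u p) \<inter> S = {}"
    then show "D.awalk u p v"
      unfolding delete_verts_def by (intro awalk_induce) auto
  qed
qed

lemma (in graph) visible_iff_not_critical:
  assumes "connected G" "u \<in> verts G" "v \<in> verts G" "X \<subseteq> verts G"
  shows "visible G X u v \<longleftrightarrow> \<not> critical G u v (X - {u, v})"
proof -
  let ?S = "X - {u, v}"
  interpret D: digraph "delete_verts G ?S" by (rule digraph_delete_verts)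
  \<comment> \<open>Removing the ends from \<open>X\<close> turns visibility into disjointness, the
    form in which \<open>awalk_delete_verts_iff\<close> applies.\<close>
  have visible: "visible G X u v \<longleftrightarrow>
      (\<exists>p. shortest_path G u p v \<and> set (awalk_verts u p) \<inter> ?S = {})"
    unfolding visible_def by (intro ex_cong1 conj_cong) auto
  have critical: "\<not> critical G u v ?S \<longleftrightarrow> graph_dist (delete_verts G ?S) u v \<le> graph_dist G u v"
    using assms(4) by (auto simp: critical_def not_less)
  show ?thesis
  proof
    assume "visible G X u v"
    then obtain p where p: "shortest_path G u p v" "set (awalk_verts u p) \<inter> ?S = {}"
      unfolding visible by blast
    then have "D.awalk u p v"
      using awalk_delete_verts_iff[OF assms(2)] by (auto simp: shortest_path_def apath_def)
    from D.graph_dist_le_length[OF this] p(1) show "\<not> critical G u v ?S"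
      unfolding critical by (simp add: shortest_path_def)
  next
    assume "\<not> critical G u v ?S"
    then have le: "graph_dist (delete_verts G ?S) u v \<le> graph_dist G u v"
      unfolding critical .
    \<comment> \<open>Connectedness enters here: with \<open>le\<close>, the finite distance in
      \<open>G\<close> keeps \<open>v\<close> reachable from \<open>u\<close> after the deletion, so
      a shortest path exists there.\<close>
    have "graph_dist G u v < \<infinity>"
      unfolding graph_dist_def \<mu>_reach_conv by (rule reachable_if_connected[OF assms(1-3)])
    with le have "graph_dist (delete_verts G ?S) u v < \<infinity>" by (rule le_less_trans)
    then have "u \<rightarrow>\<^sup>*\<^bsub>delete_verts G ?S\<^esub> v"
      unfolding graph_dist_def D.\<mu>_reach_conv .
    then obtain p where p: "shortest_path (delete_verts G ?S) u p v"
      using D.ex_shortest_path by blast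
    then have walk: "awalk u p v" and avoids: "set (awalk_verts u p) \<inter> ?S = {}"
      using awalk_delete_verts_iff[OF assms(2)] by (auto simp: shortest_path_def D.apath_def)
    have "D.awalk_verts = awalk_verts"
      unfolding delete_verts_def by (rule awalk_verts_induce)
    with p walk have "apath u p v"
      by (simp add: shortest_path_def D.apath_def apath_def)
    \<comment> \<open>One inequality is \<open>le\<close>; the other holds because \<open>p\<close>
      is also a walk of \<open>G\<close>.\<close>
    moreover have "ereal (real (length p)) = graph_dist G u v"
      using p le graph_dist_le_length[OF walk] by (simp add: shortest_path_def)
    ultimately show "visible G X u v"
      unfolding visible using avoids by (auto simp: shortest_path_def)
  qed
qed

text \<open>A shortest path is no longer than \<open>q\<close>, so it has at most one arc and no
  inner vertex that \<open>X\<close> could block.\<close>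

lemma (in fin_digraph) visible_if_short_awalk:
  assumes "awalk u q v" "length q \<le> 1"
  shows "visible G X u v"
proof -
  obtain p where p: "shortest_path G u p v"
    using ex_shortest_path assms(1) reachable_awalk by blast
  then have "ereal (real (length p)) \<le> ereal (real (length q))"
    using graph_dist_le_length[OF assms(1)] by (simp add: shortest_path_def)
  with assms(2) have "length p \<le> 1" by simp
  then have "p = [] \<or> (\<exists>e. p = [e])"
    by (cases p) auto
  with p have "set (awalk_verts u p) \<subseteq> {u, v}"
    by (auto simp: shortest_path_def apath_simps)
  with p show ?thesis
    unfolding visible_def by blast
qed

theorem theorem5p1:
  fixes G :: "('a,'b) pre_digraph"
  assumes "graph G" and "Digraph_Component.connected G"
  shows "(\<forall>X. independent_set G X \<longrightarrow> mutual_visibility_set G X) \<longleftrightarrow>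
    \<not> (\<exists>S. independent_set G S \<and> strong_critical_set G S)"
proof -
  interpret graph G by fact
  have adj_sym: "y \<rightarrow>\<^bsub>G\<^esub> x" if "x \<rightarrow>\<^bsub>G\<^esub> y" for x y
    using that by (rule graph_symmetric)
  show ?thesis
  proof (intro iffI notI allI impI)
    assume all_mv: "\<forall>X. independent_set G X \<longrightarrow> mutual_visibility_set G X"
    assume "\<exists>S. independent_set G S \<and> strong_critical_set G S"
    then obtain S u v where S: "independent_set G S" "strong_critical G u v S"
      and uv: "u \<in> verts G" "v \<in> verts G"
      unfolding strong_critical_set_def by blast
    let ?X = "S \<union> {u, v}"
    have "?X - {u, v} = S" and X: "?X \<subseteq> verts G"
      using S(2) uv by (auto simp: strong_critical_def critical_def)
    with S(2) have not_visible: "\<not> visible G ?X u v"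
      using visible_iff_not_critical[OF assms(2) uv X] by (simp add: strong_critical_def)
    have "u \<noteq> v"
      using not_visible visible_if_short_awalk[of u "[]" v] uv by (auto simp: awalk_simps)
    moreover have "\<not> u \<rightarrow>\<^bsub>G\<^esub> v"
    proof
      assume "u \<rightarrow>\<^bsub>G\<^esub> v"
      then obtain e where "awalk u [e] v"
        using uv by (auto simp: arcs_ends_conv awalk_simps)
      then show False
        using not_visible visible_if_short_awalk by fastforce
    qed
    \<comment> \<open>Strong criticality only excludes arcs from \<open>u\<close> and
      \<open>v\<close> into \<open>S\<close>; symmetry excludes the reverse ones.\<close>
    ultimately have "independent_set G ?X"
      using S X by (auto simp: independent_set_def strong_critical_def dest: adj_sym adj_not_same)
    with all_mv \<open>u \<noteq> v\<close> not_visible show False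
      by (auto simp: mutual_visibility_set_def)
  next
    fix X
    assume no_critical: "\<not> (\<exists>S. independent_set G S \<and> strong_critical_set G S)"
      and X: "independent_set G X"
    have "visible G X u v" if uv: "u \<in> X" "v \<in> X" for u v
    proof -
      have verts: "u \<in> verts G" "v \<in> verts G" "X \<subseteq> verts G"
        using X uv by (auto simp: independent_set_def)
      have "independent_set G (X - {u, v})"
        using X by (auto simp: independent_set_def)
      then have "\<not> strong_critical G u v (X - {u, v})"
        using no_critical verts by (auto simp: strong_critical_set_def)
      \<comment> \<open>Since \<open>u\<close> and \<open>v\<close> lie in the independent set
        \<open>X\<close>, criticality of \<open>X - {u, v}\<close> would already be strong.\<close>
      then have "\<not> critical G u v (X - {u, v})"
        using X uv by (auto simp: strong_critical_def independent_set_def)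
      then show ?thesis
        using visible_iff_not_critical[OF assms(2) verts] by simp
    qed
    with X show "mutual_visibility_set G X"
      by (auto simp: mutual_visibility_set_def independent_set_def)
  qed
qed

end
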